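(* Let $\nu\in\mathcal{M}$ be a signed measure with Jordan decomposition $(\nu^{-},\nu^{+})$. Then the infimum in the definition $$\mathrm{LOP}(\nu)=\inf\big\{\Vert\nu-\mu\Vert \;:\; \mu\in\mathcal{M}^{+}\big\}$$ is attained on the unique element of $\mathcal{M}^{+}$, which is the measure $\nu^{+}$, and thus the index $\mathrm{LOP}$ can be written as $$\mathrm{LOP}(\nu)=\Vert\nu^{-}\Vert .$$
   Context: Let $\varOmega$ be a set equipped with a sigma-algebra. $\mathcal{M}$ denotes the set of all (signed) measures $\nu$ defined on the sigma-algebra, and $\mathcal{M}^{+}\subset\mathcal{M}$ denotes the subset of all positive (i.e. non-negative) measures. For $\nu\in\mathcal{M}$, with $(\varOmega^{-},\varOmega^{+})$ denoting a Hahn decomposition of $\varOmega$ for $\nu$, let $(\nu^{-},\nu^{+})$ be the Jordan decomposition of $\nu$, so that $\nu=\nu^{+}-\nu^{-}$, where $\nu^{-}$ and $\nu^{+}$ are elements of $\mathcal{M}^{+}$ concentrated on $\varOmega^{-}$ and $\varOmega^{+}$ respectively. The variation of $\nu$ is $|\nu|=\nu^{-}+\nu^{+}$, and its total variation is $\Vert\nu\Vert=|\nu|(\varOmega)$. The index of lack of positivity (LOP) of $\nu\in\mathcal{M}$ is defined by $$\mathrm{LOP}(\nu)=\inf\{\Vert\nu-\mu\Vert : \mu\in\mathcal{M}^{+}\},$$ where $\Vert\cdot\Vert$ denotes the total variation. *)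

theory Defs
  imports "HOL-Analysis.Analysis" "HOL-Library.Function_Algebras"
begin

text \<open>
  A signed measure on the sigma-algebra \<open>\<A>\<close> over \<open>\<Omega>\<close> is a finite, i.e. real-valued, countably
  additive set function. It is encoded as a total function on sets; as for the library's
  \<open>measure\<close>, the value outside \<open>\<A>\<close> is fixed to be \<open>0\<close>, so that equality of functions is equality
  of signed measures. The sum and the difference of signed measures are the pointwise ones.
\<close>

definition signed_measures :: "'a set \<Rightarrow> 'a set set \<Rightarrow> ('a set \<Rightarrow> real) set" where
  "signed_measures \<Omega> \<A> = {\<nu>. \<nu> {} = 0 \<and> (\<forall>X. X \<notin> \<A> \<longrightarrow> \<nu> X = 0) \<and>
     (\<forall>F :: nat \<Rightarrow> 'a set. range F \<subseteq> \<A> \<longrightarrow> disjoint_family F \<longrightarrow> (\<lambda>i. \<nu> (F i)) sums \<nu> (\<Union>i. F i))}"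

definition positive_measures :: "'a set \<Rightarrow> 'a set set \<Rightarrow> ('a set \<Rightarrow> real) set" where
  "positive_measures \<Omega> \<A> = {\<mu> \<in> signed_measures \<Omega> \<A>. \<forall>X\<in>\<A>. 0 \<le> \<mu> X}"

definition hahn_decomposition ::
    "'a set \<Rightarrow> 'a set set \<Rightarrow> ('a set \<Rightarrow> real) \<Rightarrow> 'a set \<Rightarrow> 'a set \<Rightarrow> bool" where
  "hahn_decomposition \<Omega> \<A> \<nu> N P \<longleftrightarrow>
     N \<in> \<A> \<and> P \<in> \<A> \<and> N \<union> P = \<Omega> \<and> N \<inter> P = {} \<and>
     (\<forall>X\<in>\<A>. X \<subseteq> N \<longrightarrow> \<nu> X \<le> 0) \<and> (\<forall>X\<in>\<A>. X \<subseteq> P \<longrightarrow> 0 \<le> \<nu> X)"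

definition concentrated_on :: "'a set set \<Rightarrow> ('a set \<Rightarrow> real) \<Rightarrow> 'a set \<Rightarrow> bool" where
  "concentrated_on \<A> \<mu> S \<longleftrightarrow> (\<forall>X\<in>\<A>. X \<inter> S = {} \<longrightarrow> \<mu> X = 0)"

definition jordan_decomposition ::
    "'a set \<Rightarrow> 'a set set \<Rightarrow> ('a set \<Rightarrow> real) \<Rightarrow> ('a set \<Rightarrow> real) \<times> ('a set \<Rightarrow> real) \<Rightarrow> bool" where
  "jordan_decomposition \<Omega> \<A> \<nu> = (\<lambda>(\<nu>m, \<nu>p).
     \<nu>m \<in> positive_measures \<Omega> \<A> \<and> \<nu>p \<in> positive_measures \<Omega> \<A> \<and> \<nu> = \<nu>p - \<nu>m \<and>
     (\<exists>N P. hahn_decomposition \<Omega> \<A> \<nu> N P \<and> concentrated_on \<A> \<nu>m N \<and> concentrated_on \<A> \<nu>p P))"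

text \<open>Existence and uniqueness of the pair are shown in \<open>ex1_jordan_decomposition\<close> below.\<close>

definition jordan :: "'a set \<Rightarrow> 'a set set \<Rightarrow> ('a set \<Rightarrow> real) \<Rightarrow> ('a set \<Rightarrow> real) \<times> ('a set \<Rightarrow> real)" where
  "jordan \<Omega> \<A> \<nu> = (THE d. jordan_decomposition \<Omega> \<A> \<nu> d)"

definition neg_part :: "'a set \<Rightarrow> 'a set set \<Rightarrow> ('a set \<Rightarrow> real) \<Rightarrow> 'a set \<Rightarrow> real" where
  "neg_part \<Omega> \<A> \<nu> = fst (jordan \<Omega> \<A> \<nu>)"

definition pos_part :: "'a set \<Rightarrow> 'a set set \<Rightarrow> ('a set \<Rightarrow> real) \<Rightarrow> 'a set \<Rightarrow> real" where
  "pos_part \<Omega> \<A> \<nu> = snd (jordan \<Omega> \<A> \<nu>)"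

definition variation :: "'a set \<Rightarrow> 'a set set \<Rightarrow> ('a set \<Rightarrow> real) \<Rightarrow> 'a set \<Rightarrow> real" where
  "variation \<Omega> \<A> \<nu> = neg_part \<Omega> \<A> \<nu> + pos_part \<Omega> \<A> \<nu>"

definition total_variation :: "'a set \<Rightarrow> 'a set set \<Rightarrow> ('a set \<Rightarrow> real) \<Rightarrow> real" where
  "total_variation \<Omega> \<A> \<nu> = variation \<Omega> \<A> \<nu> \<Omega>"

definition LOP :: "'a set \<Rightarrow> 'a set set \<Rightarrow> ('a set \<Rightarrow> real) \<Rightarrow> real" where
  "LOP \<Omega> \<A> \<nu> = Inf {total_variation \<Omega> \<A> (\<nu> - \<mu>) | \<mu>. \<mu> \<in> positive_measures \<Omega> \<A>}"

subsection \<open>Existence and uniqueness of the Jordan decomposition\<close>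

lemma signed_measure_sums:
  assumes "\<nu> \<in> signed_measures \<Omega> \<A>" "range F \<subseteq> \<A>" "disjoint_family (F :: nat \<Rightarrow> 'a set)"
  shows "(\<lambda>i. \<nu> (F i)) sums \<nu> (\<Union>i. F i)"
  using assms by (auto simp: signed_measures_def)

lemma signed_measure_Un:
  assumes \<nu>: "\<nu> \<in> signed_measures \<Omega> \<A>" and A: "sigma_algebra \<Omega> \<A>"
    and XY: "X \<in> \<A>" "Y \<in> \<A>" "X \<inter> Y = {}"
  shows "\<nu> (X \<union> Y) = \<nu> X + \<nu> Y"
proof -
  interpret sigma_algebra \<Omega> \<A> by fact
  have "(\<lambda>i. \<nu> (binaryset X Y i)) sums \<nu> (\<Union>i. binaryset X Y i)"
    using XY by (intro signed_measure_sums[OF \<nu>])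
      (auto simp: range_binaryset_eq disjoint_family_on_def binaryset_def)
  moreover have "(\<lambda>i. \<nu> (binaryset X Y i)) sums (\<nu> X + \<nu> Y)"
    using \<nu> by (intro binaryset_sums) (auto simp: signed_measures_def)
  ultimately show ?thesis
    by (simp add: UN_binaryset_eq sums_unique2)
qed

lemma signed_measure_split:
  assumes \<nu>: "\<nu> \<in> signed_measures \<Omega> \<A>" and A: "sigma_algebra \<Omega> \<A>"
    and "X \<in> \<A>" "S \<in> \<A>"
  shows "\<nu> X = \<nu> (X \<inter> S) + \<nu> (X - S)"
proof -
  interpret sigma_algebra \<Omega> \<A> by fact
  have "\<nu> ((X \<inter> S) \<union> (X - S)) = \<nu> (X \<inter> S) + \<nu> (X - S)"
    using assms by (intro signed_measure_Un[OF \<nu> A]) auto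
  moreover have "(X \<inter> S) \<union> (X - S) = X" by auto
  ultimately show ?thesis by simp
qed

lemma signed_measure_uminus:
  assumes "\<nu> \<in> signed_measures \<Omega> \<A>"
  shows "(\<lambda>X. - \<nu> X) \<in> signed_measures \<Omega> \<A>"
  using assms by (auto simp: signed_measures_def intro!: sums_minus)

lemma signed_measure_restrict:
  assumes \<nu>: "\<nu> \<in> signed_measures \<Omega> \<A>" and A: "sigma_algebra \<Omega> \<A>" and S: "S \<in> \<A>"
  shows "(\<lambda>X. if X \<in> \<A> then \<nu> (X \<inter> S) else 0) \<in> signed_measures \<Omega> \<A>"
proof -
  interpret sigma_algebra \<Omega> \<A> by fact
  have "(\<lambda>i. if F i \<in> \<A> then \<nu> (F i \<inter> S) else 0) sums
      (if (\<Union>i. F i) \<in> \<A> then \<nu> ((\<Union>i. F i) \<inter> S) else 0)"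
    if F: "range F \<subseteq> \<A>" "disjoint_family F" for F :: "nat \<Rightarrow> 'a set"
  proof -
    have "(\<lambda>i. \<nu> (F i \<inter> S)) sums \<nu> (\<Union>i. F i \<inter> S)"
      using F S by (intro signed_measure_sums[OF \<nu>]) (auto simp: disjoint_family_on_def)
    moreover have "F i \<in> \<A>" for i using F by auto
    moreover have "(\<Union>i. F i) \<in> \<A>" using F by (intro countable_UN) auto
    ultimately show ?thesis by simp
  qed
  then show ?thesis using \<nu> by (auto simp: signed_measures_def)
qed

lemma signed_measure_exhaust:
  assumes \<nu>: "\<nu> \<in> signed_measures \<Omega> \<A>" and A: "sigma_algebra \<Omega> \<A>"
    and D: "D \<in> \<A>" and "\<B> \<subseteq> \<A>"
    and \<B>: "\<And>E. E \<in> \<A> \<Longrightarrow> \<exists>B\<in>\<B>. B \<subseteq> E \<and> (\<forall>C\<in>\<A>. C \<subseteq> E \<longrightarrow> min 1 (\<nu> C) \<le> 2 * \<nu> B)"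
  obtains B :: "nat \<Rightarrow> 'a set" where "range B \<subseteq> \<B>" "disjoint_family B" "\<And>n. B n \<subseteq> D"
    "\<And>C. C \<in> \<A> \<Longrightarrow> C \<subseteq> D - (\<Union>n. B n) \<Longrightarrow> \<nu> C \<le> 0"
proof -
  interpret sigma_algebra \<Omega> \<A> by fact
  from \<B> obtain g where g: "\<And>E. E \<in> \<A> \<Longrightarrow> g E \<in> \<B>" "\<And>E. E \<in> \<A> \<Longrightarrow> g E \<subseteq> E"
    "\<And>E C. E \<in> \<A> \<Longrightarrow> C \<in> \<A> \<Longrightarrow> C \<subseteq> E \<Longrightarrow> min 1 (\<nu> C) \<le> 2 * \<nu> (g E)"
    by metis
  define E where "E = rec_nat D (\<lambda>_ X. X - g X)"
  have E0: "E 0 = D" and ES: "E (Suc n) = E n - g (E n)" for n by (auto simp: E_def)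
  have EA: "E n \<in> \<A>" for n
    by (induction n) (use D g(1) \<open>\<B> \<subseteq> \<A>\<close> in \<open>auto simp: E0 ES\<close>)
  have dec: "decseq E" by (rule decseq_SucI) (auto simp: ES)
  define B where "B n = g (E n)" for n
  have BA: "range B \<subseteq> \<A>" using g(1)[OF EA] \<open>\<B> \<subseteq> \<A>\<close> by (auto simp: B_def)
  have BE: "B n \<subseteq> E n" for n using g(2)[OF EA] by (simp add: B_def)
  have disj_less: "B m \<inter> B n = {}" if "m < n" for m n
  proof -
    have "E n \<subseteq> E (Suc m)" using dec that by (auto simp: decseq_def)
    then show ?thesis using BE[of n] by (auto simp: ES B_def)
  qed
  have disj: "disjoint_family B"
    unfolding disjoint_family_on_def by (metis disj_less inf_commute linorder_neqE_nat)
  have "summable (\<lambda>n. \<nu> (B n))"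
    using signed_measure_sums[OF \<nu> BA disj] by (rule sums_summable)
  then have lim: "(\<lambda>n. 2 * \<nu> (B n)) \<longlonglongrightarrow> 2 * 0"
    by (intro tendsto_intros summable_LIMSEQ_zero)
  have rest: "D - (\<Union>n. B n) \<subseteq> E n" for n
    by (induction n) (auto simp: E0 ES B_def)
  show ?thesis
  proof (rule that[of B])
    show "range B \<subseteq> \<B>" using g(1)[OF EA] by (auto simp: B_def)
    show "disjoint_family B" by fact
    show "B n \<subseteq> D" for n using BE[of n] dec E0 by (auto simp: decseq_def)
    fix C assume C: "C \<in> \<A>" "C \<subseteq> D - (\<Union>n. B n)"
    have "min 1 (\<nu> C) \<le> 2 * \<nu> (B n)" for n
      unfolding B_def using C rest[of n] by (intro g(3) EA) auto
    then have "min 1 (\<nu> C) \<le> 2 * 0"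
      by (intro LIMSEQ_le_const[OF lim]) auto
    then show "\<nu> C \<le> 0" by linarith
  qed
qed

lemma signed_measure_large_subset:
  assumes \<nu>: "\<nu> \<in> signed_measures \<Omega> \<A>" and A: "sigma_algebra \<Omega> \<A>" and E: "E \<in> \<A>"
  shows "\<exists>B\<in>\<A>. B \<subseteq> E \<and> 0 \<le> \<nu> B \<and> (\<forall>C\<in>\<A>. C \<subseteq> E \<longrightarrow> min 1 (\<nu> C) \<le> 2 * \<nu> B)"
proof -
  interpret sigma_algebra \<Omega> \<A> by fact
  define T where "T = (\<lambda>C. min 1 (\<nu> C)) ` {C \<in> \<A>. C \<subseteq> E}"
  have bdd: "bdd_above T" by (auto simp: T_def intro!: bdd_aboveI[where M = 1])
  have "\<nu> {} = 0" using \<nu> by (simp add: signed_measures_def)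
  then have "0 \<in> T" by (force simp: T_def)
  then have "0 \<le> Sup T" using bdd by (rule cSup_upper)
  have up: "min 1 (\<nu> C) \<le> Sup T" if "C \<in> \<A>" "C \<subseteq> E" for C
    using that bdd by (intro cSup_upper) (auto simp: T_def)
  show ?thesis
  proof (cases "Sup T = 0")
    case True
    then show ?thesis using up \<open>\<nu> {} = 0\<close> by (intro bexI[of _ "{}"]) auto
  next
    case False
    then have "Sup T / 2 < Sup T" using \<open>0 \<le> Sup T\<close> by simp
    then obtain t where "t \<in> T" "Sup T / 2 < t"
      using \<open>0 \<in> T\<close> less_cSupE by blast
    moreover from \<open>t \<in> T\<close> obtain B where "B \<in> \<A>" "B \<subseteq> E" "t = min 1 (\<nu> B)"
      by (auto simp: T_def)
    ultimately have B: "B \<in> \<A>" "B \<subseteq> E" "Sup T / 2 < min 1 (\<nu> B)"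
      by simp_all
    show ?thesis
    proof (rule bexI[of _ B], intro conjI ballI impI)
      show "0 \<le> \<nu> B" using B(3) \<open>0 \<le> Sup T\<close> by linarith
      fix C assume "C \<in> \<A>" "C \<subseteq> E"
      from up[OF this] show "min 1 (\<nu> C) \<le> 2 * \<nu> B" using B(3) by linarith
    qed (use B in auto)
  qed
qed

lemma signed_measure_negative_subset:
  assumes \<nu>: "\<nu> \<in> signed_measures \<Omega> \<A>" and A: "sigma_algebra \<Omega> \<A>" and D: "D \<in> \<A>"
  shows "\<exists>N\<in>\<A>. N \<subseteq> D \<and> \<nu> N \<le> \<nu> D \<and> (\<forall>C\<in>\<A>. C \<subseteq> N \<longrightarrow> \<nu> C \<le> 0)"
proof -
  interpret sigma_algebra \<Omega> \<A> by fact
  let ?\<B> = "{B \<in> \<A>. 0 \<le> \<nu> B}"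
  obtain B :: "nat \<Rightarrow> 'a set" where B: "range B \<subseteq> ?\<B>" "disjoint_family B" "\<And>n. B n \<subseteq> D"
    "\<And>C. C \<in> \<A> \<Longrightarrow> C \<subseteq> D - (\<Union>n. B n) \<Longrightarrow> \<nu> C \<le> 0"
  proof (rule signed_measure_exhaust[OF \<nu> A D, of ?\<B>])
    show "\<exists>B\<in>?\<B>. B \<subseteq> E \<and> (\<forall>C\<in>\<A>. C \<subseteq> E \<longrightarrow> min 1 (\<nu> C) \<le> 2 * \<nu> B)"
      if "E \<in> \<A>" for E
      using signed_measure_large_subset[OF \<nu> A that] by blast
  qed auto
  have BA: "range B \<subseteq> \<A>" using B(1) by auto
  then have U: "(\<Union>n. B n) \<in> \<A>" by (intro countable_UN) auto
  have sums: "(\<lambda>n. \<nu> (B n)) sums \<nu> (\<Union>n. B n)"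
    using signed_measure_sums[OF \<nu> BA B(2)] .
  have "0 \<le> \<nu> (B n)" for n using B(1) by auto
  then have "0 \<le> \<nu> (\<Union>n. B n)" by (rule sums_le[OF _ sums_zero sums])
  moreover have "D \<inter> (\<Union>n. B n) = (\<Union>n. B n)" using B(3) by auto
  ultimately have "\<nu> (D - (\<Union>n. B n)) \<le> \<nu> D"
    using signed_measure_split[OF \<nu> A D U] by simp
  then show ?thesis using B(4) D U by (intro bexI[of _ "D - (\<Union>n. B n)"]) auto
qed

lemma ex_hahn_decomposition:
  assumes \<nu>: "\<nu> \<in> signed_measures \<Omega> \<A>" and A: "sigma_algebra \<Omega> \<A>"
  shows "\<exists>N P. hahn_decomposition \<Omega> \<A> \<nu> N P"
proof -
  interpret sigma_algebra \<Omega> \<A> by fact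
  let ?\<nu> = "\<lambda>X. - \<nu> X"
  let ?\<B> = "{B \<in> \<A>. \<forall>C\<in>\<A>. C \<subseteq> B \<longrightarrow> \<nu> C \<le> 0}"
  have m: "?\<nu> \<in> signed_measures \<Omega> \<A>" using \<nu> by (rule signed_measure_uminus)
  have ex: "\<exists>B\<in>?\<B>. B \<subseteq> E \<and> (\<forall>C\<in>\<A>. C \<subseteq> E \<longrightarrow> min 1 (?\<nu> C) \<le> 2 * ?\<nu> B)" if E: "E \<in> \<A>" for E
  proof -
    obtain B where B: "B \<in> \<A>" "B \<subseteq> E" "\<And>C. C \<in> \<A> \<Longrightarrow> C \<subseteq> E \<Longrightarrow> min 1 (?\<nu> C) \<le> 2 * ?\<nu> B"
      using signed_measure_large_subset[OF m A E] by blast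
    obtain N where N: "N \<in> \<A>" "N \<subseteq> B" "\<nu> N \<le> \<nu> B" "\<And>C. C \<in> \<A> \<Longrightarrow> C \<subseteq> N \<Longrightarrow> \<nu> C \<le> 0"
      using signed_measure_negative_subset[OF \<nu> A B(1)] by blast
    have "min 1 (?\<nu> C) \<le> 2 * ?\<nu> N" if "C \<in> \<A>" "C \<subseteq> E" for C
      using B(3)[OF that] N(3) by linarith
    then show ?thesis using B N by (intro bexI[of _ N]) auto
  qed
  obtain B :: "nat \<Rightarrow> 'a set" where B: "range B \<subseteq> ?\<B>" "disjoint_family B" "\<And>n. B n \<subseteq> \<Omega>"
    "\<And>C. C \<in> \<A> \<Longrightarrow> C \<subseteq> \<Omega> - (\<Union>n. B n) \<Longrightarrow> ?\<nu> C \<le> 0"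
  proof (rule signed_measure_exhaust[OF m A top, of ?\<B>])
    show "\<exists>B\<in>?\<B>. B \<subseteq> E \<and> (\<forall>C\<in>\<A>. C \<subseteq> E \<longrightarrow> min 1 (?\<nu> C) \<le> 2 * ?\<nu> B)"
      if "E \<in> \<A>" for E
      using that by (rule ex)
  qed auto
  define N where "N = (\<Union>n. B n)"
  have N: "N \<in> \<A>" unfolding N_def using B(1) by (intro countable_UN) auto
  have "\<nu> X \<le> 0" if X: "X \<in> \<A>" "X \<subseteq> N" for X
  proof -
    have sums: "(\<lambda>n. \<nu> (X \<inter> B n)) sums \<nu> (\<Union>n. X \<inter> B n)"
    proof (rule signed_measure_sums[OF \<nu>])
      show "range (\<lambda>n. X \<inter> B n) \<subseteq> \<A>" using B(1) X(1) by auto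
      show "disjoint_family (\<lambda>n. X \<inter> B n)"
        using B(2) unfolding disjoint_family_on_def by blast
    qed
    have "(\<Union>n. X \<inter> B n) = X" using X(2) by (auto simp: N_def)
    moreover have "\<nu> (X \<inter> B n) \<le> 0" for n
    proof -
      have "B n \<in> \<A>" "\<forall>C\<in>\<A>. C \<subseteq> B n \<longrightarrow> \<nu> C \<le> 0" using B(1) by auto
      moreover from this have "X \<inter> B n \<in> \<A>" using X(1) by auto
      ultimately show ?thesis by auto
    qed
    ultimately show ?thesis using sums_le[OF _ sums sums_zero] by simp
  qed
  moreover have "0 \<le> \<nu> X" if "X \<in> \<A>" "X \<subseteq> \<Omega> - N" for X
    using B(4)[of X] that by (simp add: N_def)
  moreover have "N \<subseteq> \<Omega>" using N sets_into_space by blast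
  ultimately have "hahn_decomposition \<Omega> \<A> \<nu> N (\<Omega> - N)"
    using N unfolding hahn_decomposition_def by auto
  then show ?thesis by blast
qed

lemma jordan_decomposition_unique:
  assumes \<nu>: "\<nu> \<in> signed_measures \<Omega> \<A>" and A: "sigma_algebra \<Omega> \<A>"
    and "jordan_decomposition \<Omega> \<A> \<nu> (m, p)" "jordan_decomposition \<Omega> \<A> \<nu> (m', p')"
  shows "(m, p) = (m', p')"
proof -
  interpret sigma_algebra \<Omega> \<A> by fact
  obtain N P where h: "hahn_decomposition \<Omega> \<A> \<nu> N P" "concentrated_on \<A> m N" "concentrated_on \<A> p P"
    and mp: "m \<in> positive_measures \<Omega> \<A>" "p \<in> positive_measures \<Omega> \<A>" "\<nu> = p - m"
    using assms(3) by (auto simp: jordan_decomposition_def)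
  obtain N' P' where h': "hahn_decomposition \<Omega> \<A> \<nu> N' P'" "concentrated_on \<A> m' N'"
      "concentrated_on \<A> p' P'"
    and mp': "m' \<in> positive_measures \<Omega> \<A>" "p' \<in> positive_measures \<Omega> \<A>" "\<nu> = p' - m'"
    using assms(4) by (auto simp: jordan_decomposition_def)
  have eq: "p X = \<nu> (X \<inter> P)"
    if "hahn_decomposition \<Omega> \<A> \<nu> N P" "concentrated_on \<A> m N" "concentrated_on \<A> p P"
      "p \<in> positive_measures \<Omega> \<A>" "\<nu> = p - m" "X \<in> \<A>" for N P m p X
  proof -
    have s: "p \<in> signed_measures \<Omega> \<A>" and P: "P \<in> \<A>" "N \<inter> P = {}"
      using that by (auto simp: positive_measures_def hahn_decomposition_def)
    have "X - P \<in> \<A>" "X \<inter> P \<in> \<A>" "(X - P) \<inter> P = {}" "X \<inter> P \<inter> N = {}"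
      using \<open>X \<in> \<A>\<close> P by auto
    then have "p (X - P) = 0" "m (X \<inter> P) = 0"
      using that(2,3) by (simp_all add: concentrated_on_def)
    then show ?thesis using signed_measure_split[OF s A \<open>X \<in> \<A>\<close> P(1)] that(5) by simp
  qed
  have pp: "p X = p' X" if X: "X \<in> \<A>" for X
  proof -
    have null: "\<nu> (X \<inter> P) = \<nu> (X \<inter> P \<inter> P')"
      if "hahn_decomposition \<Omega> \<A> \<nu> N P" "hahn_decomposition \<Omega> \<A> \<nu> N' P'" for N P N' P'
    proof -
      have PA: "P \<in> \<A>" "P' \<in> \<A>" and cov: "N' \<union> P' = \<Omega>"
        and pos: "\<And>Y. Y \<in> \<A> \<Longrightarrow> Y \<subseteq> P \<Longrightarrow> 0 \<le> \<nu> Y" and neg: "\<And>Y. Y \<in> \<A> \<Longrightarrow> Y \<subseteq> N' \<Longrightarrow> \<nu> Y \<le> 0"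
        using that unfolding hahn_decomposition_def by simp_all
      have Y: "X \<inter> P \<in> \<A>" "X \<inter> P - P' \<in> \<A>" using X PA by auto
      have "X \<inter> P - P' \<subseteq> N'" using cov sets_into_space[OF X] by blast
      then have "\<nu> (X \<inter> P - P') = 0" using pos[OF Y(2)] neg[OF Y(2)] by force
      then show ?thesis using signed_measure_split[OF \<nu> A Y(1) PA(2)] by simp
    qed
    have "\<nu> (X \<inter> P) = \<nu> (X \<inter> P')"
      using null[OF h(1) h'(1)] null[OF h'(1) h(1)] by (simp add: Int_ac)
    then show ?thesis
      using eq[OF h mp(2,3) X] eq[OF h' mp'(2,3) X] by simp
  qed
  moreover have "p X = p' X" if "X \<notin> \<A>" for X
    using mp(2) mp'(2) that by (auto simp: positive_measures_def signed_measures_def)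
  ultimately have "p = p'" by blast
  moreover have "m X = p X - \<nu> X" "m' X = p' X - \<nu> X" for X
    using fun_cong[OF mp(3), of X] fun_cong[OF mp'(3), of X] by simp_all
  ultimately show ?thesis by (simp add: fun_eq_iff)
qed

lemma ex1_jordan_decomposition:
  assumes \<nu>: "\<nu> \<in> signed_measures \<Omega> \<A>" and A: "sigma_algebra \<Omega> \<A>"
  shows "\<exists>!d. jordan_decomposition \<Omega> \<A> \<nu> d"
proof -
  interpret sigma_algebra \<Omega> \<A> by fact
  obtain N P where h: "hahn_decomposition \<Omega> \<A> \<nu> N P" using ex_hahn_decomposition[OF \<nu> A] by blast
  have d: "N \<in> \<A>" "P \<in> \<A>" "N \<union> P = \<Omega>" "N \<inter> P = {}"
    and neg: "\<And>X. X \<in> \<A> \<Longrightarrow> \<nu> (X \<inter> N) \<le> 0" and nn: "\<And>X. X \<in> \<A> \<Longrightarrow> 0 \<le> \<nu> (X \<inter> P)"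
    using h by (simp_all add: hahn_decomposition_def Int)
  define p where "p = (\<lambda>X. if X \<in> \<A> then \<nu> (X \<inter> P) else 0)"
  define m where "m = (\<lambda>X. - (if X \<in> \<A> then \<nu> (X \<inter> N) else 0))"
  have z: "\<nu> {} = 0" "\<And>X. X \<notin> \<A> \<Longrightarrow> \<nu> X = 0" using \<nu> by (auto simp: signed_measures_def)
  have "p \<in> signed_measures \<Omega> \<A>" "m \<in> signed_measures \<Omega> \<A>"
    unfolding p_def m_def
    by (intro signed_measure_uminus signed_measure_restrict[OF \<nu> A] d)+
  then have pos: "p \<in> positive_measures \<Omega> \<A>" "m \<in> positive_measures \<Omega> \<A>"
    using neg nn by (auto simp: positive_measures_def p_def m_def)
  have "\<nu> X = (p - m) X" for X
  proof (cases "X \<in> \<A>")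
    case True
    have "X - P = X \<inter> N" using d True sets_into_space by blast
    then show ?thesis using signed_measure_split[OF \<nu> A True, of P] d True
      by (simp add: p_def m_def)
  qed (simp add: p_def m_def z)
  then have eq: "\<nu> = p - m" by (rule ext)
  have "concentrated_on \<A> m N" "concentrated_on \<A> p P"
    by (simp_all add: concentrated_on_def p_def m_def z)
  then have ex: "jordan_decomposition \<Omega> \<A> \<nu> (m, p)"
    unfolding jordan_decomposition_def prod.case using pos eq h by blast
  show ?thesis
  proof (rule ex1I, rule ex)
    fix d assume "jordan_decomposition \<Omega> \<A> \<nu> d"
    then show "d = (m, p)"
      using jordan_decomposition_unique[OF \<nu> A _ ex] by (cases d) blast
  qed
qed

lemma jordan_decomposition_parts:
  assumes "\<nu> \<in> signed_measures \<Omega> \<A>" "sigma_algebra \<Omega> \<A>"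
  shows "jordan_decomposition \<Omega> \<A> \<nu> (neg_part \<Omega> \<A> \<nu>, pos_part \<Omega> \<A> \<nu>)"
  using theI'[OF ex1_jordan_decomposition[OF assms]]
  by (simp add: neg_part_def pos_part_def jordan_def)

end

theory Submission
  imports Defs
begin

text \<open>
  Let \<open>(N, P)\<close> be a Hahn decomposition of \<open>\<Omega>\<close> for \<open>\<nu>\<close>. On \<open>N\<close>, subtracting a positive measure
  \<open>\<mu>\<close> from \<open>\<nu>\<close> can only make a negative number more negative, so it costs at least \<open>\<mu> N\<close>;
  on \<open>P\<close>, the choice \<open>\<mu> = \<nu>\<^sup>+\<close> costs nothing at all. Since the variation is a positive measure
  that dominates the absolute value of \<open>\<nu> - \<mu>\<close>, cutting \<open>\<Omega>\<close> into \<open>N\<close> and \<open>P\<close> makes this precise: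
  \<open>\<parallel>\<nu> - \<mu>\<parallel> \<ge> \<nu>\<^sup>- \<Omega> + \<mu> N + \<bar>\<nu> - \<mu>\<bar> P\<close> (lemma \<open>total_variation_diff_ge\<close>).

  Both of the last summands are nonnegative. They vanish for \<open>\<mu> = \<nu>\<^sup>+\<close>, where the difference is
  \<open>- \<nu>\<^sup>-\<close>; so the infimum is \<open>\<nu>\<^sup>- \<Omega> = \<parallel>\<nu>\<^sup>-\<parallel>\<close>. Conversely, if \<open>\<mu>\<close> attains the infimum, then both
  summands vanish: \<open>\<mu>\<close> is null on \<open>N\<close> and agrees with \<open>\<nu>\<close> on \<open>P\<close>, and hence it is \<open>\<nu>\<^sup>+\<close>.
\<close>

lemma positive_measure_mono:
  assumes \<mu>: "\<mu> \<in> positive_measures \<Omega> \<A>" and A: "sigma_algebra \<Omega> \<A>"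
    and X: "X \<in> \<A>" and Y: "Y \<in> \<A>" and "X \<subseteq> Y"
  shows "\<mu> X \<le> \<mu> Y"
proof -
  interpret sigma_algebra \<Omega> \<A> by fact
  have "\<mu> \<in> signed_measures \<Omega> \<A>" and nn: "0 \<le> \<mu> (Y - X)"
    using \<mu> X Y by (auto simp: positive_measures_def)
  moreover have "Y \<inter> X = X" using \<open>X \<subseteq> Y\<close> by auto
  ultimately show ?thesis using signed_measure_split[OF _ A Y X, of \<mu>] by simp
qed

lemma signed_measure_add:
  assumes "\<nu> \<in> signed_measures \<Omega> \<A>" "\<mu> \<in> signed_measures \<Omega> \<A>"
  shows "\<nu> + \<mu> \<in> signed_measures \<Omega> \<A>"
  using assms by (auto simp: signed_measures_def intro!: sums_add)

lemma signed_measure_diff: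
  assumes "\<nu> \<in> signed_measures \<Omega> \<A>" "\<mu> \<in> signed_measures \<Omega> \<A>"
  shows "\<nu> - \<mu> \<in> signed_measures \<Omega> \<A>"
  using assms by (auto simp: signed_measures_def intro!: sums_diff)

lemma total_variation_eqI:
  assumes "\<nu> \<in> signed_measures \<Omega> \<A>" "sigma_algebra \<Omega> \<A>"
    and "jordan_decomposition \<Omega> \<A> \<nu> (m, p)"
  shows "total_variation \<Omega> \<A> \<nu> = m \<Omega> + p \<Omega>"
  using jordan_decomposition_unique[OF assms(1,2) jordan_decomposition_parts[OF assms(1,2)] assms(3)]
  by (simp add: total_variation_def variation_def)

lemma total_variation_positive_measure:
  assumes \<mu>: "\<mu> \<in> positive_measures \<Omega> \<A>" and A: "sigma_algebra \<Omega> \<A>"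
  shows "total_variation \<Omega> \<A> \<mu> = \<mu> \<Omega>" and "total_variation \<Omega> \<A> (- \<mu>) = \<mu> \<Omega>"
proof -
  interpret sigma_algebra \<Omega> \<A> by fact
  have s: "\<mu> \<in> signed_measures \<Omega> \<A>" "- \<mu> \<in> signed_measures \<Omega> \<A>"
    and nn: "\<And>X. X \<in> \<A> \<Longrightarrow> 0 \<le> \<mu> X" and z: "\<mu> {} = 0"
    using \<mu> signed_measure_uminus[of \<mu> \<Omega> \<A>]
    by (auto simp: positive_measures_def signed_measures_def fun_Compl_def)
  have zero: "0 \<in> positive_measures \<Omega> \<A>"
    by (auto simp: positive_measures_def signed_measures_def)
  have conc: "concentrated_on \<A> \<mu> \<Omega>" "concentrated_on \<A> 0 {}"
    using z by (simp_all add: concentrated_on_def Int_absorb2 sets_into_space)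
  \<comment> \<open>The Hahn decomposition is trivial in both cases: no mass is negative, or all of it is.\<close>
  have "hahn_decomposition \<Omega> \<A> \<mu> {} \<Omega>" "hahn_decomposition \<Omega> \<A> (- \<mu>) \<Omega> {}"
    using nn z by (auto simp: hahn_decomposition_def)
  moreover have "\<mu> = \<mu> - 0" "- \<mu> = 0 - \<mu>" by simp_all
  ultimately have "jordan_decomposition \<Omega> \<A> \<mu> (0, \<mu>)" "jordan_decomposition \<Omega> \<A> (- \<mu>) (\<mu>, 0)"
    unfolding jordan_decomposition_def prod.case using \<mu> zero conc by blast+
  then show "total_variation \<Omega> \<A> \<mu> = \<mu> \<Omega>" "total_variation \<Omega> \<A> (- \<mu>) = \<mu> \<Omega>"
    using total_variation_eqI[OF s(1) A] total_variation_eqI[OF s(2) A] by simp_all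
qed

lemma variation_positive_measure:
  assumes "\<nu> \<in> signed_measures \<Omega> \<A>" "sigma_algebra \<Omega> \<A>"
  shows "variation \<Omega> \<A> \<nu> \<in> positive_measures \<Omega> \<A>"
  using jordan_decomposition_parts[OF assms]
  by (auto simp: jordan_decomposition_def positive_measures_def variation_def
      intro: signed_measure_add)

text \<open>This is the triangle inequality for the two terms of \<open>\<nu> X = \<nu>\<^sup>+ X - \<nu>\<^sup>- X\<close>.\<close>

lemma abs_le_variation:
  assumes "\<nu> \<in> signed_measures \<Omega> \<A>" "sigma_algebra \<Omega> \<A>" "X \<in> \<A>"
  shows "\<bar>\<nu> X\<bar> \<le> variation \<Omega> \<A> \<nu> X"
proof -
  let ?m = "neg_part \<Omega> \<A> \<nu>" and ?p = "pos_part \<Omega> \<A> \<nu>"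
  have "?m \<in> positive_measures \<Omega> \<A>" "?p \<in> positive_measures \<Omega> \<A>" "\<nu> = ?p - ?m"
    using jordan_decomposition_parts[OF assms(1,2)] by (auto simp: jordan_decomposition_def)
  then have "0 \<le> ?m X" "0 \<le> ?p X" "\<nu> X = ?p X - ?m X"
    using \<open>X \<in> \<A>\<close> by (auto simp: positive_measures_def dest: fun_cong[where x = X])
  then show ?thesis by (simp add: variation_def)
qed

text \<open>
  The excess of \<open>\<parallel>\<nu> - \<mu>\<parallel>\<close> over \<open>\<nu>\<^sup>- \<Omega>\<close> controls both the mass that \<open>\<mu>\<close> puts on the negative set
  and the deviation of \<open>\<mu>\<close> from \<open>\<nu>\<close> on the positive set. Keeping these two terms, rather than only
  the bound \<open>\<nu>\<^sup>- \<Omega>\<close>, is what gives uniqueness of the minimiser.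
\<close>

lemma total_variation_diff_ge:
  assumes \<nu>: "\<nu> \<in> signed_measures \<Omega> \<A>" and A: "sigma_algebra \<Omega> \<A>"
    and \<mu>: "\<mu> \<in> positive_measures \<Omega> \<A>"
    and hahn: "hahn_decomposition \<Omega> \<A> \<nu> N P"
    and conc: "concentrated_on \<A> (neg_part \<Omega> \<A> \<nu>) N" "concentrated_on \<A> (pos_part \<Omega> \<A> \<nu>) P"
  shows "neg_part \<Omega> \<A> \<nu> \<Omega> + \<mu> N + variation \<Omega> \<A> (\<nu> - \<mu>) P \<le> total_variation \<Omega> \<A> (\<nu> - \<mu>)"
proof -
  interpret sigma_algebra \<Omega> \<A> by fact
  let ?m = "neg_part \<Omega> \<A> \<nu>" and ?p = "pos_part \<Omega> \<A> \<nu>" and ?v = "variation \<Omega> \<A> (\<nu> - \<mu>)"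
  have NP: "N \<in> \<A>" "P \<in> \<A>" "N \<inter> P = {}" "P \<inter> N = {}" "N \<union> P = \<Omega>"
    using hahn by (auto simp: hahn_decomposition_def)
  have d: "\<nu> - \<mu> \<in> signed_measures \<Omega> \<A>"
    using \<nu> \<mu> by (auto simp: positive_measures_def intro: signed_measure_diff)
  have parts: "?m \<in> signed_measures \<Omega> \<A>" "\<nu> = ?p - ?m"
    using jordan_decomposition_parts[OF \<nu> A]
    by (auto simp: jordan_decomposition_def positive_measures_def)
  have "?m P = 0" "?p N = 0"
    using conc NP by (auto simp: concentrated_on_def)
  then have "\<nu> N = - ?m \<Omega>"
    using signed_measure_Un[OF parts(1) A NP(1-3)] NP(5) fun_cong[OF parts(2), of N] by simp
  then have "?m \<Omega> + \<mu> N \<le> \<bar>(\<nu> - \<mu>) N\<bar>" by simp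
  also have "\<dots> \<le> ?v N" using abs_le_variation[OF d A NP(1)] .
  finally have "?m \<Omega> + \<mu> N + ?v P \<le> ?v N + ?v P" by simp
  also have "\<dots> = total_variation \<Omega> \<A> (\<nu> - \<mu>)"
    using signed_measure_Un[OF _ A NP(1-3), of ?v] variation_positive_measure[OF d A] NP(5)
    by (simp add: positive_measures_def total_variation_def)
  finally show ?thesis .
qed

theorem theorem2:
  fixes \<Omega> :: "'a set" and \<A> :: "'a set set" and \<nu> :: "'a set \<Rightarrow> real"
  assumes "sigma_algebra \<Omega> \<A>"
    and "\<nu> \<in> signed_measures \<Omega> \<A>"
  shows "{\<mu> \<in> positive_measures \<Omega> \<A>. total_variation \<Omega> \<A> (\<nu> - \<mu>) = LOP \<Omega> \<A> \<nu>} = {pos_part \<Omega> \<A> \<nu>}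
    \<and> LOP \<Omega> \<A> \<nu> = total_variation \<Omega> \<A> (neg_part \<Omega> \<A> \<nu>)"
proof -
  interpret sigma_algebra \<Omega> \<A> by fact
  note A = assms(1) and \<nu> = assms(2)
  let ?m = "neg_part \<Omega> \<A> \<nu>" and ?p = "pos_part \<Omega> \<A> \<nu>"
  obtain N P where parts: "?m \<in> positive_measures \<Omega> \<A>" "?p \<in> positive_measures \<Omega> \<A>" "\<nu> = ?p - ?m"
    and hahn: "hahn_decomposition \<Omega> \<A> \<nu> N P"
    and conc: "concentrated_on \<A> ?m N" "concentrated_on \<A> ?p P"
    using jordan_decomposition_parts[OF \<nu> A] by (auto simp: jordan_decomposition_def)
  have NP: "N \<in> \<A>" "P \<in> \<A>" "N \<inter> P = {}" "N \<union> P = \<Omega>"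
    using hahn by (auto simp: hahn_decomposition_def)
  note ge = total_variation_diff_ge[OF \<nu> A _ hahn conc]
  have diff: "\<nu> - \<mu> \<in> signed_measures \<Omega> \<A>" if "\<mu> \<in> positive_measures \<Omega> \<A>" for \<mu>
    using \<nu> that by (auto simp: positive_measures_def intro: signed_measure_diff)
  have nn: "0 \<le> \<mu> N" "0 \<le> variation \<Omega> \<A> (\<nu> - \<mu>) P" if "\<mu> \<in> positive_measures \<Omega> \<A>" for \<mu>
    using that NP variation_positive_measure[OF diff[OF that] A]
    by (auto simp: positive_measures_def)
  have "\<nu> - ?p = - ?m" using parts(3) by (simp add: algebra_simps)
  then have attained: "total_variation \<Omega> \<A> (\<nu> - ?p) = ?m \<Omega>"
    using total_variation_positive_measure(2)[OF parts(1) A] by simp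
  have LOP: "LOP \<Omega> \<A> \<nu> = ?m \<Omega>"
    unfolding LOP_def
  proof (rule cInf_eq_minimum)
    show "?m \<Omega> \<in> {total_variation \<Omega> \<A> (\<nu> - \<mu>) |\<mu>. \<mu> \<in> positive_measures \<Omega> \<A>}"
      using attained parts(2) by force
    show "?m \<Omega> \<le> x" if "x \<in> {total_variation \<Omega> \<A> (\<nu> - \<mu>) |\<mu>. \<mu> \<in> positive_measures \<Omega> \<A>}" for x
      using that ge nn by force
  qed
  have unique: "\<mu> = ?p"
    if \<mu>: "\<mu> \<in> positive_measures \<Omega> \<A>" and opt: "total_variation \<Omega> \<A> (\<nu> - \<mu>) = ?m \<Omega>" for \<mu>
  proof
    fix X
    have s: "\<mu> \<in> signed_measures \<Omega> \<A>" "?p \<in> signed_measures \<Omega> \<A>"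
      using \<mu> parts by (auto simp: positive_measures_def)
    have v: "variation \<Omega> \<A> (\<nu> - \<mu>) \<in> positive_measures \<Omega> \<A>"
      by (rule variation_positive_measure[OF diff[OF \<mu>] A])
    have null: "\<mu> N = 0" "variation \<Omega> \<A> (\<nu> - \<mu>) P = 0"
      using ge[OF \<mu>] nn[OF \<mu>] opt by linarith+
    show "\<mu> X = ?p X"
    proof (cases "X \<in> \<A>")
      case True
      have XA: "X \<inter> P \<in> \<A>" "X - P \<in> \<A>" using True NP by auto
      have "X - P \<subseteq> N" using sets_into_space[OF True] NP(4) by auto
      then have "\<mu> (X - P) \<le> \<mu> N" by (rule positive_measure_mono[OF \<mu> A XA(2) NP(1)])
      moreover have "0 \<le> \<mu> (X - P)" using \<mu> XA by (auto simp: positive_measures_def)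
      ultimately have off: "\<mu> (X - P) = 0" using null(1) by simp
      have "\<bar>(\<nu> - \<mu>) (X \<inter> P)\<bar> \<le> variation \<Omega> \<A> (\<nu> - \<mu>) (X \<inter> P)"
        by (rule abs_le_variation[OF diff[OF \<mu>] A XA(1)])
      also have "\<dots> \<le> variation \<Omega> \<A> (\<nu> - \<mu>) P"
        by (rule positive_measure_mono[OF v A XA(1) NP(2)]) auto
      finally have "\<mu> (X \<inter> P) = \<nu> (X \<inter> P)" using null(2) by simp
      moreover have "?m (X \<inter> P) = 0" "?p (X - P) = 0"
        using conc XA NP(3) by (auto simp: concentrated_on_def Int_ac)
      moreover have "\<nu> (X \<inter> P) = ?p (X \<inter> P) - ?m (X \<inter> P)"
        using fun_cong[OF parts(3)] by simp
      ultimately show ?thesis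
        using off signed_measure_split[OF s(1) A True NP(2)] signed_measure_split[OF s(2) A True NP(2)]
        by simp
    next
      case False
      then show ?thesis using s by (simp add: signed_measures_def)
    qed
  qed
  have "{\<mu> \<in> positive_measures \<Omega> \<A>. total_variation \<Omega> \<A> (\<nu> - \<mu>) = ?m \<Omega>} = {?p}"
    using attained parts(2) unique by blast
  then show ?thesis
    unfolding LOP total_variation_positive_measure(1)[OF parts(1) A] by simp
qed

end
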